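(* Let $(\xi_1,\eta_1),(\xi_2,\eta_2),\ldots$ be independent copies of an $\mathbb{R}^2$-valued random vector $(\xi,\eta)$ with arbitrarily dependent components, and let $S_0:=0$, $S_k:=\xi_1+\ldots+\xi_k$ for $k\in\mathbb{N}$. Assume that $\mu:=\mathbb{E}\xi\in(0,\infty)$ and $\mathbb{E}|\eta|<\infty$, and put $m:=\mathbb{E}\eta$. Then $$\lim_{b\to 1-}(1-b)\sum_{k\geq 0}b^{S_k}\eta_{k+1}=\mu^{-1}m\quad\text{almost surely}.$$
   Context: Here $b\in(0,1)$ and $b\to1-$ is the continuous limit from the left. Under the stated assumptions the series $\sum_{k\ge0}b^{S_k}\eta_{k+1}$ converges absolutely almost surely for all $b\in(0,1)$. *)

theory Defs
  imports "HOL-Probability.Probability"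
begin

text \<open>The copies of a random vector are indexed by \<open>1, 2, \<dots>\<close>;
  the value of a sequence at index \<open>0\<close> is never used.\<close>

definition independent_copies ::
    "'a measure \<Rightarrow> ('a \<Rightarrow> real \<times> real) \<Rightarrow> (nat \<Rightarrow> 'a \<Rightarrow> real \<times> real) \<Rightarrow> bool" where
  "independent_copies M Z Zs \<longleftrightarrow>
     prob_space.indep_vars M (\<lambda>_. borel) Zs {1..} \<and>
     (\<forall>k\<ge>1. distr M borel (Zs k) = distr M borel Z)"

definition random_walk :: "(nat \<Rightarrow> 'a \<Rightarrow> real) \<Rightarrow> nat \<Rightarrow> 'a \<Rightarrow> real" where
  "random_walk \<xi>s k \<omega> = (\<Sum>i=1..k. \<xi>s i \<omega>)"

end

theory Submission
  imports Defs
begin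

text \<open>
  The randomness enters only through the strong law of large numbers: almost surely
  \<open>S\<^sub>n / n \<rightarrow> \<mu>\<close>, and the averages of \<open>\<eta>\<^sup>+\<close> and of \<open>\<eta>\<^sup>-\<close> converge to their expectations. From then on the
  argument is deterministic, which is how it accommodates an arbitrary dependence between \<open>\<xi>\<close> and
  \<open>\<eta>\<close>. For nonnegative
  weights \<open>a\<close> with averages tending to \<open>L\<close>, monotonicity in the exponent squeezes
  \<open>\<Sum>n. b\<^bsup>S n\<^esup> a n\<close> between two sums of the form \<open>\<Sum>n. b\<^bsup>c n\<^esup> a n\<close> with \<open>c\<close> close to \<open>\<mu>\<close>, up to finitely
  many terms (\<open>discounted_sum_along_linear_walk\<close>). Such a sum is a power series in \<open>q = b\<^sup>c\<close>, and
  convergence of averages implies \<open>(1 - q) \<Sum>n. q\<^sup>n a n \<rightarrow> L\<close> (\<open>abelian_mean\<close>); since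
  \<open>(1 - b) / (1 - b\<^sup>c) \<rightarrow> 1 / c\<close>, the limit is \<open>L / c\<close> (\<open>abelian_mean_powr\<close>). The theorem is the difference of the results
  for \<open>\<eta>\<^sup>+\<close> and \<open>\<eta>\<^sup>-\<close>, and their sum gives absolute convergence.

  The strong law is obtained from a maximal argument in the spirit of ergodic theory: an i.i.d.
  walk with negative mean increment is almost surely bounded above (\<open>AE_sums_bounded\<close>). Subtracting
  from the increments a constant slightly above their mean gives the upper bound on the averages, and a change
  of sign gives the lower one.
\<close>

section \<open>Maxima of a random walk with negative drift\<close>

definition tail :: "(nat \<Rightarrow> real) \<Rightarrow> nat \<Rightarrow> real" where
  "tail x = (\<lambda>i. x (Suc i))"

lemma tail_apply [simp]: "tail x i = x (Suc i)"
  by (simp add: tail_def)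

lemma tail_case_nat [simp]: "tail (case_nat s x) = x"
  by (simp add: tail_def)

text \<open>The maximum of the partial sums of lengths \<open>0, \<dots>, n\<close>. The recursion splits off the
  \<^emph>\<open>first\<close> increment, so that passing from \<open>n\<close> to \<open>n + 1\<close> is one step of the Lindley recursion
  applied to the shifted sequence; this is what makes shift invariance usable.\<close>

primrec walk_max :: "nat \<Rightarrow> (nat \<Rightarrow> real) \<Rightarrow> real" where
  "walk_max 0 x = 0"
| "walk_max (Suc n) x = max 0 (x 0 + walk_max n (tail x))"

lemma walk_max_nonneg: "0 \<le> walk_max n x"
  by (cases n) auto

lemma walk_max_mono_Suc: "walk_max n x \<le> walk_max (Suc n) x"
proof (induction n arbitrary: x)
  case (Suc n)
  have "walk_max n (tail x) \<le> walk_max (Suc n) (tail x)"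
    by (rule Suc)
  then show ?case by simp
qed simp

lemma walk_max_mono: "m \<le> n \<Longrightarrow> walk_max m x \<le> walk_max n x"
  by (rule lift_Suc_mono_le[of "\<lambda>n. walk_max n x"]) (rule walk_max_mono_Suc)

lemma sum_le_walk_max: "(\<Sum>i<n. x i) \<le> walk_max n x"
proof (induction n arbitrary: x)
  case (Suc n)
  have "(\<Sum>i<n. tail x i) \<le> walk_max n (tail x)"
    by (rule Suc)
  then show ?case
    by (simp add: sum.lessThan_Suc_shift del: sum.lessThan_Suc)
qed simp

lemma walk_max_le_sum_abs: "walk_max n x \<le> (\<Sum>i<n. \<bar>x i\<bar>)"
proof (induction n arbitrary: x)
  case (Suc n)
  have "0 \<le> (\<Sum>i<n. \<bar>x (Suc i)\<bar>)" by (simp add: sum_nonneg)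
  moreover have "walk_max n (tail x) \<le> (\<Sum>i<n. \<bar>tail x i\<bar>)"
    by (rule Suc)
  ultimately show ?case
    by (simp add: sum.lessThan_Suc_shift del: sum.lessThan_Suc)
qed simp

text \<open>This event does not depend on the first term, so it is both invariant under the shift
  and independent of the first coordinate.\<close>

definition unbounded_sums :: "(nat \<Rightarrow> real) \<Rightarrow> bool" where
  "unbounded_sums x \<longleftrightarrow> (\<forall>N::nat. \<exists>n. real N < (\<Sum>i<n. x i))"

lemma unbounded_sums_tail: "unbounded_sums (tail x) \<longleftrightarrow> unbounded_sums x"
proof
  assume *: "unbounded_sums (tail x)"
  show "unbounded_sums x"
    unfolding unbounded_sums_def
  proof
    fix N :: nat
    obtain K :: nat where K: "\<bar>x 0\<bar> \<le> real K" using real_arch_simple by blast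
    obtain n where "real (N + K) < (\<Sum>i<n. x (Suc i))"
      using * unfolding unbounded_sums_def tail_apply by blast
    then have "real N < (\<Sum>i<Suc n. x i)"
      using K by (simp add: sum.lessThan_Suc_shift del: sum.lessThan_Suc)
    then show "\<exists>n. real N < (\<Sum>i<n. x i)" ..
  qed
next
  assume *: "unbounded_sums x"
  show "unbounded_sums (tail x)"
    unfolding unbounded_sums_def
  proof
    fix N :: nat
    obtain K :: nat where K: "\<bar>x 0\<bar> \<le> real K" using real_arch_simple by blast
    obtain n where n: "real (N + K) < (\<Sum>i<n. x i)"
      using * unfolding unbounded_sums_def by blast
    then obtain m where "n = Suc m" by (cases n) auto
    then have "real N < (\<Sum>i<m. x (Suc i))"
      using K n by (simp add: sum.lessThan_Suc_shift del: sum.lessThan_Suc)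
    then show "\<exists>n. real N < (\<Sum>i<n. tail x i)" by auto
  qed
qed

lemma walk_max_at_top:
  assumes "unbounded_sums x"
  shows "filterlim (\<lambda>n. walk_max n x) at_top sequentially"
  unfolding filterlim_at_top_ge[where c=0]
proof (intro allI impI)
  fix Z :: real
  obtain N :: nat where N: "Z \<le> real N" using real_arch_simple by blast
  obtain n where n: "real N < (\<Sum>i<n. x i)"
    using assms unfolding unbounded_sums_def by blast
  have "Z \<le> walk_max k x" if "n \<le> k" for k
    using N n sum_le_walk_max[of x n] walk_max_mono[OF that, of x] by linarith
  then show "\<forall>\<^sub>F n in sequentially. Z \<le> walk_max n x"
    unfolding eventually_sequentially by blast
qed

text \<open>The canonical space of an i.i.d. sequence with integrable marginal \<open>D\<close>: here the shift is a
  measure preserving map and the first coordinate is independent of the shifted sequence.\<close>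

locale integrable_sequence_space = sequence_space D for D :: "real measure" +
  assumes sets_D: "sets D = sets borel"
    and integrable_D: "integrable D (\<lambda>s. s)"
begin

lemma measurable_id_D[measurable]: "(\<lambda>s. s) \<in> borel_measurable D"
  by (simp add: measurable_cong_sets[OF sets_D refl])

lemma measurable_coord[measurable]: "(\<lambda>x. x i) \<in> borel_measurable S"
proof -
  have "(\<lambda>x. x i) \<in> measurable S D" by simp
  then show ?thesis by (simp add: measurable_cong_sets[OF refl sets_D])
qed

lemma measurable_tail[measurable]: "tail \<in> measurable S S"
  unfolding tail_def[abs_def] by (rule measurable_PiM_single') (auto simp: space_PiM)

lemma measurable_walk_max[measurable]: "walk_max n \<in> borel_measurable S"
proof (induction n)
  case (Suc n)
  note Suc[measurable]
  have "(\<lambda>x. max 0 (x 0 + walk_max n (tail x))) \<in> borel_measurable S"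
    by measurable
  then show ?case by simp
qed simp

lemma measurable_unbounded_sums[measurable]: "Measurable.pred S unbounded_sums"
  unfolding unbounded_sums_def[abs_def] by measurable

lemma distr_tail: "distr S S tail = S"
  using distr_PiM_reindex[of UNIV "\<lambda>_. D" Suc UNIV] by (simp add: M.prob_space_axioms restrict_def tail_def[abs_def])

lemma integrable_coord: "integrable S (\<lambda>x. x i)"
proof -
  have "integrable (distr S D (\<lambda>x. x i)) (\<lambda>s. s)"
    using PiM_component[of i] integrable_D by simp
  then show ?thesis by (rule integrable_distr[rotated]) simp
qed

lemma integrable_walk_max: "integrable S (walk_max n)"
proof (rule Bochner_Integration.integrable_bound[of _ "\<lambda>x. \<Sum>i<n. \<bar>x i\<bar>"])
  show "integrable S (\<lambda>x. \<Sum>i<n. \<bar>x i\<bar>)"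
    by (intro Bochner_Integration.integrable_sum integrable_abs integrable_coord)
  show "AE x in S. norm (walk_max n x) \<le> norm (\<Sum>i<n. \<bar>x i\<bar>)"
    using walk_max_le_sum_abs[of n] walk_max_nonneg[of n]
    by (auto intro!: AE_I2 simp: sum_nonneg)
qed simp

text \<open>The event of unbounded sums is determined by the shifted sequence, hence independent of the
  first coordinate, and the expectation factors.\<close>

lemma integral_coord_unbounded:
  "(\<integral>x. indicator {x. unbounded_sums x} x * x 0 \<partial>S)
    = measure S {x \<in> space S. unbounded_sums x} * (\<integral>s. s \<partial>D)"
proof -
  let ?h = "\<lambda>x::nat \<Rightarrow> real. indicator {x. unbounded_sums x} x :: real"
  have [measurable]: "?h \<in> borel_measurable S"
    by measurable
  interpret Q: pair_sigma_finite D S ..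
  have h: "integrable S ?h"
    by (rule P.integrable_const_bound[where B=1]) (auto simp: indicator_def)
  have int: "integrable (D \<Otimes>\<^sub>M S) (\<lambda>(s, x). ?h x * s)"
  proof (rule Q.Fubini_integrable)
    show "integrable D (\<lambda>s. \<integral>x. norm (case (s, x) of (s, x) \<Rightarrow> ?h x * s) \<partial>S)"
      using integrable_abs[OF integrable_D] by (simp add: abs_mult)
  qed (use h in auto)
  \<comment> \<open>Resample the sequence as a fresh first term \<open>s\<close> followed by an independent copy \<open>x\<close>.\<close>
  have "(\<integral>x. ?h x * x 0 \<partial>S) = (\<integral>x. ?h x * x 0 \<partial>distr (D \<Otimes>\<^sub>M S) S (\<lambda>(s, x). case_nat s x))"
    by (simp add: PiM_iter)
  also have "\<dots> = (\<integral>(s, x). ?h (case_nat s x) * s \<partial>(D \<Otimes>\<^sub>M S))"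
    by (subst integral_distr) (auto intro!: Bochner_Integration.integral_cong)
  also have "\<dots> = (\<integral>(s, x). ?h x * s \<partial>(D \<Otimes>\<^sub>M S))"
    using unbounded_sums_tail[of "case_nat s x" for s x]
    by (auto intro!: Bochner_Integration.integral_cong simp: indicator_def)
  also have "\<dots> = (\<integral>s. \<integral>x. ?h x * s \<partial>S \<partial>D)"
    using Q.integral_fst'[OF int] by simp
  also have "\<dots> = measure S {x \<in> space S. unbounded_sums x} * (\<integral>s. s \<partial>D)"
    by (simp add: Int_def conj_commute)
  finally show ?thesis .
qed

text \<open>Let \<open>M\<^sub>n\<close> be the walk maximum and \<open>A\<close> the event of unbounded sums. Since
  \<open>M\<^sub>n\<^sub>+\<^sub>1 = max 0 (x\<^sub>0 + M\<^sub>n \<circ> tail)\<close>, the difference \<open>M\<^sub>n\<^sub>+\<^sub>1 - M\<^sub>n \<circ> tail\<close> equals \<open>max (- M\<^sub>n \<circ> tail) x\<^sub>0\<close>.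
  Its integral over the invariant event \<open>A\<close> is that of \<open>M\<^sub>n\<^sub>+\<^sub>1 - M\<^sub>n \<ge> 0\<close>, because the shift
  preserves the measure. On \<open>A\<close> the maxima tend to infinity, so the integrand tends to \<open>x\<^sub>0\<close>, and
  dominated convergence leaves \<open>0 \<le> \<integral>\<^sub>A x\<^sub>0 = P(A) E x\<^sub>0\<close>. A negative mean forces \<open>P(A) = 0\<close>.\<close>

lemma AE_sums_bounded:
  assumes neg: "(\<integral>s. s \<partial>D) < 0"
  shows "AE x in S. \<not> unbounded_sums x"
proof -
  let ?h = "\<lambda>x::nat \<Rightarrow> real. indicator {x. unbounded_sums x} x :: real"
  have [measurable]: "?h \<in> borel_measurable S"
    by measurable
  have h_tail: "?h (tail x) = ?h x" for x
    by (simp add: indicator_def unbounded_sums_tail)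
  have int: "integrable S (\<lambda>x. ?h x * walk_max n x)" for n
    by (rule Bochner_Integration.integrable_bound[OF integrable_walk_max[of n]]) 
       (auto simp: indicator_def)
  have int': "integrable S (\<lambda>x. ?h x * walk_max n (tail x))"
    and shift: "(\<integral>x. ?h x * walk_max n (tail x) \<partial>S) = (\<integral>x. ?h x * walk_max n x \<partial>S)" for n
  proof -
    have "integrable (distr S S tail) (\<lambda>x. ?h x * walk_max n x)"
      using int by (simp add: distr_tail)
    then show "integrable S (\<lambda>x. ?h x * walk_max n (tail x))"
      using integrable_distr[OF measurable_tail, of "\<lambda>x. ?h x * walk_max n x"] by (simp add: h_tail)
    have "(\<integral>x. ?h x * walk_max n x \<partial>S) = (\<integral>x. ?h x * walk_max n x \<partial>distr S S tail)"
      by (simp add: distr_tail)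
    also have "\<dots> = (\<integral>x. ?h x * walk_max n (tail x) \<partial>S)"
      by (subst integral_distr) (auto simp: h_tail)
    finally show "(\<integral>x. ?h x * walk_max n (tail x) \<partial>S) = (\<integral>x. ?h x * walk_max n x \<partial>S)" ..
  qed
  have incr: "0 \<le> (\<integral>x. ?h x * max (- walk_max n (tail x)) (x 0) \<partial>S)" for n
  proof -
    have "0 \<le> (\<integral>x. ?h x * walk_max (Suc n) x \<partial>S) - (\<integral>x. ?h x * walk_max n x \<partial>S)"
      using integral_mono[OF int[of n] int[of "Suc n"]]
      by (simp add: mult_left_mono walk_max_mono_Suc del: walk_max.simps)
    also have "\<dots> = (\<integral>x. ?h x * walk_max (Suc n) x - ?h x * walk_max n (tail x) \<partial>S)"
      using int[of "Suc n"] int'[of n] by (simp add: shift del: walk_max.simps)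
    also have "\<dots> = (\<integral>x. ?h x * max (- walk_max n (tail x)) (x 0) \<partial>S)"
      by (rule Bochner_Integration.integral_cong) (auto simp: indicator_def max_def)
    finally show ?thesis .
  qed
  have "(\<lambda>n. \<integral>x. ?h x * max (- walk_max n (tail x)) (x 0) \<partial>S) \<longlonglongrightarrow> (\<integral>x. ?h x * x 0 \<partial>S)"
  proof (rule integral_dominated_convergence[where w="\<lambda>x. \<bar>x 0\<bar>"])
    show "integrable S (\<lambda>x. \<bar>x 0\<bar>)" by (intro integrable_abs integrable_coord)
    show "AE x in S. norm (?h x * max (- walk_max n (tail x)) (x 0)) \<le> \<bar>x 0\<bar>" for n
      using walk_max_nonneg[of n] by (intro AE_I2) (auto simp: indicator_def max_def abs_if, smt+)
    show "AE x in S. (\<lambda>n. ?h x * max (- walk_max n (tail x)) (x 0)) \<longlonglongrightarrow> ?h x * x 0"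
    proof (intro AE_I2)
      fix x :: "nat \<Rightarrow> real"
      show "(\<lambda>n. ?h x * max (- walk_max n (tail x)) (x 0)) \<longlonglongrightarrow> ?h x * x 0"
      proof (cases "unbounded_sums x")
        case True
        then have "filterlim (\<lambda>n. walk_max n (tail x)) at_top sequentially"
          by (intro walk_max_at_top) (simp add: unbounded_sums_tail)
        then have "\<forall>\<^sub>F n in sequentially. - x 0 \<le> walk_max n (tail x)"
          by (simp add: filterlim_at_top)
        then have "\<forall>\<^sub>F n in sequentially. ?h x * max (- walk_max n (tail x)) (x 0) = ?h x * x 0"
          by eventually_elim (simp add: max_def)
        then show ?thesis by (rule tendsto_eventually)
      qed simp
    qed
  qed simp_all
  then have "0 \<le> (\<integral>x. ?h x * x 0 \<partial>S)"
    by (rule LIMSEQ_le_const) (use incr in auto)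
  then have "measure S {x \<in> space S. unbounded_sums x} = 0"
    using neg by (simp add: integral_coord_unbounded zero_le_mult_iff measure_le_0_iff)
  then show ?thesis
    by (subst AE_iff_measurable[OF _ refl]) (simp_all add: P.emeasure_eq_measure)
qed

end

section \<open>The strong law of large numbers\<close>

lemma (in prob_space) indep_vars_reindex_inj:
  assumes indep: "indep_vars M' X (f ` I)" and inj: "inj_on f I"
  shows "indep_vars (\<lambda>i. M' (f i)) (\<lambda>i. X (f i)) I"
proof -
  let ?F = "\<lambda>i. {X i -` A \<inter> space M |A. A \<in> sets (M' i)}"
  have F: "indep_sets ?F (f ` I)" and rv: "\<And>i. i \<in> f ` I \<Longrightarrow> random_variable (M' i) (X i)"
    using indep by (auto simp: indep_vars_def2)
  have "indep_sets (\<lambda>i. ?F (f i)) I"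
  proof (rule indep_setsI)
    fix i assume "i \<in> I" then show "?F (f i) \<subseteq> events"
      using F by (auto simp: indep_sets_def)
  next
    fix A J assume J: "J \<noteq> {}" "J \<subseteq> I" "finite J" and A: "\<forall>j\<in>J. A j \<in> ?F (f j)"
    have inj': "inj_on f J" using inj J by (auto intro: inj_on_subset)
    let ?A = "\<lambda>k. A (the_inv_into J f k)"
    have eq: "?A (f j) = A j" if "j \<in> J" for j
      using the_inv_into_f_f[OF inj' that] by simp
    have "prob (\<Inter>k\<in>f ` J. ?A k) = (\<Prod>k\<in>f ` J. prob (?A k))"
      using J A by (intro indep_setsD[OF F]) (auto simp: eq)
    then show "prob (\<Inter>j\<in>J. A j) = (\<Prod>j\<in>J. prob (A j))"
      by (simp add: prod.reindex[OF inj'] eq)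
  qed
  then show ?thesis
    using rv by (simp add: indep_vars_def2)
qed

lemma (in prob_space) AE_iid_sums_bounded:
  fixes X :: "nat \<Rightarrow> 'a \<Rightarrow> real"
  assumes indep: "indep_vars (\<lambda>_. borel) X UNIV"
    and id: "\<And>i. distr M borel (X i) = distr M borel (X 0)"
    and int: "integrable M (X 0)" and neg: "expectation (X 0) < 0"
  shows "AE \<omega> in M. \<not> unbounded_sums (\<lambda>i. X i \<omega>)"
proof -
  let ?D = "distr M borel (X 0)"
  have X: "random_variable borel (X i)" for i
    using indep by (simp add: indep_vars_def2)
  have D: "prob_space ?D"
    by (intro prob_space_distr X)
  \<comment> \<open>The law of the whole sequence is the product measure, which transports the statement from the canonical space.\<close>
  have "distr M (\<Pi>\<^sub>M i\<in>UNIV. borel) (\<lambda>\<omega>. \<lambda>i\<in>UNIV. X i \<omega>)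
      = (\<Pi>\<^sub>M i\<in>UNIV. distr M borel (X i))"
    by (rule iffD1[OF indep_vars_iff_distr_eq_PiM indep]) (auto intro: X)
  also have "\<dots> = (\<Pi>\<^sub>M i\<in>UNIV. ?D)"
    by (intro PiM_cong refl id)
  finally have law: "distr M (\<Pi>\<^sub>M i\<in>UNIV. borel) (\<lambda>\<omega> i. X i \<omega>) = (\<Pi>\<^sub>M i\<in>UNIV. ?D)"
    by (simp only: restrict_UNIV)
  have neg_D: "(\<integral>s. s \<partial>?D) < 0"
    using neg X by (simp add: integral_distr)
  interpret integrable_sequence_space ?D
  proof (intro integrable_sequence_space.intro sequence_space.intro integrable_sequence_space_axioms.intro)
    show "product_prob_space (\<lambda>i::nat. ?D)"
      using D by (simp add: product_prob_spaceI)
    show "integrable ?D (\<lambda>s. s)"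
      using int X by (simp add: integrable_distr_eq)
  qed simp
  have "AE x in S. \<not> unbounded_sums x"
    by (rule AE_sums_bounded) (rule neg_D)
  then have "AE x in distr M (\<Pi>\<^sub>M i\<in>UNIV. borel) (\<lambda>\<omega> i. X i \<omega>). \<not> unbounded_sums x"
    by (simp only: law)
  moreover have "(\<lambda>\<omega> i. X i \<omega>) \<in> measurable M (\<Pi>\<^sub>M i\<in>UNIV. borel)"
    by (rule measurable_PiM_single') (simp_all add: X)
  ultimately show ?thesis
    by (rule AE_distrD[rotated])
qed

lemma distr_compose_cong:
  assumes "distr M borel X = distr M borel Y" "X \<in> borel_measurable M" "Y \<in> borel_measurable M"
    and "g \<in> borel_measurable borel"
  shows "distr M borel (\<lambda>\<omega>. g (X \<omega>)) = distr M borel (\<lambda>\<omega>. g (Y \<omega>))"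
  using distr_distr[of g borel borel X M] distr_distr[of g borel borel Y M] assms
  by (simp add: comp_def)

text \<open>After subtracting a constant \<open>d\<close> strictly between the mean and \<open>c\<close>, the walk has negative drift
  and so its sums are bounded above by some \<open>N\<close>; hence the averages are at most \<open>d + N / n\<close>.\<close>

lemma (in prob_space) AE_iid_mean_less:
  fixes X :: "nat \<Rightarrow> 'a \<Rightarrow> real"
  assumes indep: "indep_vars (\<lambda>_. borel) X UNIV"
    and id: "\<And>i. distr M borel (X i) = distr M borel (X 0)"
    and int: "integrable M (X 0)" and c: "expectation (X 0) < c"
  shows "AE \<omega> in M. \<forall>\<^sub>F n in sequentially. (\<Sum>i<n. X i \<omega>) / real n < c"
proof -
  have X: "random_variable borel (X i)" for i
    using indep by (simp add: indep_vars_def2)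
  obtain d where d: "expectation (X 0) < d" "d < c"
    using dense[OF c] by blast
  have "AE \<omega> in M. \<not> unbounded_sums (\<lambda>i. X i \<omega> - d)"
  proof (rule AE_iid_sums_bounded)
    show "indep_vars (\<lambda>_. borel) (\<lambda>i \<omega>. X i \<omega> - d) UNIV"
      by (rule indep_vars_compose2[OF indep, of "\<lambda>_ x. x - d"]) simp
    show "distr M borel (\<lambda>\<omega>. X i \<omega> - d) = distr M borel (\<lambda>\<omega>. X 0 \<omega> - d)" for i
      by (rule distr_compose_cong[OF id X X, of "\<lambda>x. x - d"]) simp
    show "integrable M (\<lambda>\<omega>. X 0 \<omega> - d)" "expectation (\<lambda>\<omega>. X 0 \<omega> - d) < 0"
      using int d by (simp_all add: prob_space)
  qed
  then show ?thesis
  proof eventually_elim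
    case (elim \<omega>)
    then obtain N :: nat where N: "\<And>n. (\<Sum>i<n. X i \<omega> - d) \<le> real N"
      unfolding unbounded_sums_def by (auto simp: not_less)
    have "(\<lambda>n. real N / real n + d) \<longlonglongrightarrow> 0 + d"
      by (intro tendsto_add tendsto_const lim_const_over_n)
    then have "\<forall>\<^sub>F n in sequentially. real N / real n + d < c"
      using d by (auto dest: order_tendstoD(2))
    then show ?case
      using eventually_gt_at_top[of 0]
    proof eventually_elim
      case (elim n)
      have "(\<Sum>i<n. X i \<omega>) \<le> real N + real n * d"
        using N[of n] by (simp add: sum_subtractf)
      then have "(\<Sum>i<n. X i \<omega>) / real n \<le> real N / real n + d"
        using elim by (simp add: field_simps)
      then show ?case using elim by simp
    qed
  qed
qed

text \<open>The upper bound on the averages, applied to \<open>X\<close> and to \<open>- X\<close> with \<open>c\<close> running through a sequence that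
  decreases to the mean, so that countably many null sets suffice.\<close>

theorem (in prob_space) strong_law_of_large_numbers:
  fixes X :: "nat \<Rightarrow> 'a \<Rightarrow> real"
  assumes indep: "indep_vars (\<lambda>_. borel) X UNIV"
    and id: "\<And>i. distr M borel (X i) = distr M borel (X 0)"
    and int: "integrable M (X 0)"
  shows "AE \<omega> in M. (\<lambda>n. (\<Sum>i<n. X i \<omega>) / real n) \<longlonglongrightarrow> expectation (X 0)"
proof -
  have X: "random_variable borel (X i)" for i
    using indep by (simp add: indep_vars_def2)
  let ?E = "expectation (X 0)"
  have "AE \<omega> in M. \<forall>\<^sub>F n in sequentially. (\<Sum>i<n. X i \<omega>) / real n < ?E + inverse (Suc k)" for k
    by (rule AE_iid_mean_less[OF indep id int]) simp
  then have up: "AE \<omega> in M. \<forall>k. \<forall>\<^sub>F n in sequentially. (\<Sum>i<n. X i \<omega>) / real n < ?E + inverse (Suc k)"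
    by (simp add: AE_all_countable)
  have "AE \<omega> in M. \<forall>\<^sub>F n in sequentially. (\<Sum>i<n. - X i \<omega>) / real n < - ?E + inverse (Suc k)" for k
  proof (rule AE_iid_mean_less)
    show "indep_vars (\<lambda>_. borel) (\<lambda>i \<omega>. - X i \<omega>) UNIV"
      by (rule indep_vars_compose2[OF indep, of "\<lambda>_ x. - x"]) simp
    show "distr M borel (\<lambda>\<omega>. - X i \<omega>) = distr M borel (\<lambda>\<omega>. - X 0 \<omega>)" for i
      by (rule distr_compose_cong[OF id X X, of "\<lambda>x. - x"]) simp
  qed (use int in simp_all)
  then have low: "AE \<omega> in M. \<forall>k. \<forall>\<^sub>F n in sequentially. (\<Sum>i<n. - X i \<omega>) / real n < - ?E + inverse (Suc k)"
    by (simp add: AE_all_countable)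
  from up low show ?thesis
  proof eventually_elim
    case (elim \<omega>)
    show ?case
    proof (rule order_tendstoI)
      fix a assume "a < ?E"
      then obtain k where k: "inverse (Suc k) < ?E - a"
        using reals_Archimedean[of "?E - a"] by auto
      from elim(2)[rule_format, of k] show "\<forall>\<^sub>F n in sequentially. a < (\<Sum>i<n. X i \<omega>) / real n"
        by eventually_elim (use k in \<open>simp add: sum_negf\<close>)
    next
      fix a assume "?E < a"
      then obtain k where k: "inverse (Suc k) < a - ?E"
        using reals_Archimedean[of "a - ?E"] by auto
      from elim(1)[rule_format, of k] show "\<forall>\<^sub>F n in sequentially. (\<Sum>i<n. X i \<omega>) / real n < a"
        by eventually_elim (use k in simp)
    qed
  qed
qed

section \<open>Abelian theorems for averages\<close>

lemma eventually_at_left_1_unit: "\<forall>\<^sub>F b in at_left (1::real). 0 < b \<and> b < 1"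
  by (rule eventually_at_leftI[of 0]) auto

lemma bounded_cesaro_error:
  fixes t :: "nat \<Rightarrow> real"
  assumes "(\<lambda>n. t n / real n) \<longlonglongrightarrow> 0" and "0 < e"
  obtains C where "0 \<le> C" "\<And>n. \<bar>t n\<bar> \<le> C + e * real n"
proof -
  obtain N where N: "\<And>n. n \<ge> N \<Longrightarrow> \<bar>t n / real n\<bar> < e"
    using LIMSEQ_D[OF assms] by auto
  define C where "C = (\<Sum>i\<le>N. \<bar>t i\<bar>)"
  have "0 \<le> C" by (simp add: C_def sum_nonneg)
  moreover have "\<bar>t n\<bar> \<le> C + e * real n" for n
  proof (cases "n \<le> N")
    case True
    then have "\<bar>t n\<bar> \<le> C"
      unfolding C_def by (intro member_le_sum) auto
    moreover have "0 \<le> e * real n" using assms by simp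
    ultimately show ?thesis by linarith
  next
    case False
    then have "\<bar>t n\<bar> \<le> e * real n"
      using N[of n] by (simp add: abs_divide field_simps)
    then show ?thesis using \<open>0 \<le> C\<close> by simp
  qed
  ultimately show ?thesis using that by blast
qed

lemma summable_linear_growth:
  fixes t :: "nat \<Rightarrow> real"
  assumes "\<And>n. \<bar>t n\<bar> \<le> C * (real n + 1)" and "0 < q" "q < 1"
  shows "summable (\<lambda>n. q ^ n * t n)"
proof (rule summable_comparison_test')
  show "summable (\<lambda>n. C * (real (Suc n) * q ^ n))"
    using geometric_deriv_sums[of q] assms by (intro summable_mult) (auto simp: sums_iff)
  show "norm (q ^ n * t n) \<le> C * (real (Suc n) * q ^ n)" if "n \<ge> 0" for n
    using mult_left_mono[OF assms(1)[of n], of "q ^ n"] assms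
    by (simp add: abs_mult algebra_simps)
qed

lemma power_series_by_parts:
  fixes a :: "nat \<Rightarrow> real" and q :: real
  assumes lin: "\<And>n. \<bar>\<Sum>i<n. a i\<bar> \<le> C * (real n + 1)" and q: "0 < q" "q < 1"
  shows "summable (\<lambda>n. q ^ n * a n)"
    and "(\<Sum>n. q ^ n * a n) = (1 - q) * (\<Sum>n. q ^ n * (\<Sum>i<Suc n. a i))"
proof -
  let ?t = "\<lambda>n. \<Sum>i<n. a i"
  have s: "summable (\<lambda>n. q ^ n * ?t n)"
    by (rule summable_linear_growth[OF lin q])
  then have "summable (\<lambda>n. q * (q ^ n * ?t (Suc n)))"
    by (subst (asm) summable_Suc_iff[symmetric]) (simp add: algebra_simps)
  then have s': "summable (\<lambda>n. q ^ n * ?t (Suc n))"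
    by (subst (asm) summable_cmult_iff) (use q in auto)
  have eq: "q ^ n * a n = q ^ n * ?t (Suc n) - q ^ n * ?t n" for n
    by (simp add: algebra_simps)
  show "summable (\<lambda>n. q ^ n * a n)"
    unfolding eq by (intro summable_diff s s')
  have "(\<Sum>n. q ^ n * ?t n) = (\<Sum>n. q * (q ^ n * ?t (Suc n)))"
    using suminf_split_head[OF s] by (simp add: algebra_simps)
  also have "\<dots> = q * (\<Sum>n. q ^ n * ?t (Suc n))"
    by (rule suminf_mult[OF s'])
  finally have "(\<Sum>n. q ^ n * ?t n) = q * (\<Sum>n. q ^ n * ?t (Suc n))" .
  then show "(\<Sum>n. q ^ n * a n) = (1 - q) * (\<Sum>n. q ^ n * ?t (Suc n))"
    unfolding eq suminf_diff[OF s' s, symmetric] by (simp add: algebra_simps)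
qed

lemma linear_bound_of_cesaro:
  fixes t :: "nat \<Rightarrow> real"
  assumes "(\<lambda>n. t n / real n) \<longlonglongrightarrow> L"
  obtains C where "\<And>n. \<bar>t n\<bar> \<le> C * (real n + 1)"
proof -
  have "(\<lambda>n. t n / real n - L) \<longlonglongrightarrow> 0"
    using assms by (simp add: LIM_zero)
  moreover have "\<forall>\<^sub>F n in sequentially. t n / real n - L = (t n - L * real n) / real n"
    using eventually_gt_at_top[of 0] by eventually_elim (simp add: field_simps)
  ultimately have "(\<lambda>n. (t n - L * real n) / real n) \<longlonglongrightarrow> 0"
    by (simp cong: tendsto_cong)
  then obtain C where C: "0 \<le> C" "\<And>n. \<bar>t n - L * real n\<bar> \<le> C + 1 * real n"
    using bounded_cesaro_error[of "\<lambda>n. t n - L * real n" 1] by (metis zero_less_one)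
  have "\<bar>t n\<bar> \<le> (C + 1 + \<bar>L\<bar>) * (real n + 1)" for n
  proof -
    have "\<bar>L * real n\<bar> = \<bar>L\<bar> * real n" by (simp add: abs_mult)
    then have "\<bar>t n\<bar> \<le> C + real n + \<bar>L\<bar> * real n"
      using C(2)[of n] by linarith
    also have "\<dots> \<le> (C + 1 + \<bar>L\<bar>) * (real n + 1)"
      using C(1) by (simp add: algebra_simps)
    finally show ?thesis .
  qed
  then show ?thesis using that by blast
qed

text \<open>The theorem of Frobenius, Cesaro to Abel. Summation by parts turns the power series of \<open>a\<close> into that of its
  partial sums; the partial sums \<open>t n\<close> of \<open>a - L\<close> are at most \<open>K + \<epsilon> n\<close> in modulus, and
  \<open>\<Sum>n. (n + 1) q\<^sup>n = 1 / (1 - q)\<^sup>2\<close> turns this into an error of at most \<open>K (1 - q) + \<epsilon>\<close>.\<close>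

theorem abelian_mean:
  fixes a :: "nat \<Rightarrow> real"
  assumes "(\<lambda>n. (\<Sum>i<n. a i) / real n) \<longlonglongrightarrow> L"
  shows "\<And>q. 0 < q \<Longrightarrow> q < 1 \<Longrightarrow> summable (\<lambda>n. q ^ n * a n)"
    and "((\<lambda>q. (1 - q) * (\<Sum>n. q ^ n * a n)) \<longlongrightarrow> L) (at_left 1)"
proof -
  obtain C where lin: "\<And>n. \<bar>\<Sum>i<n. a i\<bar> \<le> C * (real n + 1)"
    using linear_bound_of_cesaro[OF assms] by blast
  note parts = power_series_by_parts[OF lin]
  show summ: "summable (\<lambda>n. q ^ n * a n)" if "0 < q" "q < 1" for q
    by (rule parts(1)[OF that])
  define t where "t n = (\<Sum>i<n. a i - L)" for n
  have t: "t n = (\<Sum>i<n. a i) - L * real n" for n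
    by (simp add: t_def sum_subtractf)
  have lim_t: "(\<lambda>n. t n / real n) \<longlonglongrightarrow> 0"
  proof -
    have "(\<lambda>n. (\<Sum>i<n. a i) / real n - L) \<longlonglongrightarrow> 0"
      using assms by (simp add: LIM_zero)
    moreover have "\<forall>\<^sub>F n in sequentially. (\<Sum>i<n. a i) / real n - L = t n / real n"
      using eventually_gt_at_top[of 0] by eventually_elim (simp add: t field_simps)
    ultimately show ?thesis
      by (simp cong: tendsto_cong)
  qed
  obtain C' where lin': "\<And>n. \<bar>\<Sum>i<n. a i - L\<bar> \<le> C' * (real n + 1)"
    using linear_bound_of_cesaro[OF lim_t] unfolding t_def by blast
  note parts' = power_series_by_parts[OF lin']
  have diff: "(1 - q) * (\<Sum>n. q ^ n * a n) - L = (1 - q)\<^sup>2 * (\<Sum>n. q ^ n * t (Suc n))"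
    if q: "0 < q" "q < 1" for q
  proof -
    have "(\<Sum>n. q ^ n * (a n - L)) = (\<Sum>n. q ^ n * a n) - (\<Sum>n. q ^ n * L)"
      using q summ[OF q] by (simp add: right_diff_distrib suminf_diff summable_mult2)
    also have "(\<Sum>n. q ^ n * L) = L / (1 - q)"
      using q by (simp add: suminf_mult2[symmetric] suminf_geometric)
    finally have "(1 - q) * (\<Sum>n. q ^ n * a n) - L = (1 - q) * (\<Sum>n. q ^ n * (a n - L))"
      using q by (simp add: field_simps)
    then show ?thesis
      using parts'(2)[OF q] by (simp add: t_def power2_eq_square)
  qed
  have bound: "\<bar>(1 - q)\<^sup>2 * (\<Sum>n. q ^ n * t (Suc n))\<bar> \<le> K * (1 - q) + e"
    if q: "0 < q" "q < 1" and K: "\<And>n. \<bar>t n\<bar> \<le> K + e * real n" for q K e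
  proof -
    have g: "summable (\<lambda>n. q ^ n)" "(\<Sum>n. q ^ n) = 1 / (1 - q)"
      using q by (auto simp: suminf_geometric)
    have d: "summable (\<lambda>n. real (Suc n) * q ^ n)" "(\<Sum>n. real (Suc n) * q ^ n) = 1 / (1 - q)\<^sup>2"
      using geometric_deriv_sums[of q] q by (auto simp: sums_iff)
    have "\<bar>\<Sum>n. q ^ n * t (Suc n)\<bar> \<le> (\<Sum>n. K * q ^ n + e * (real (Suc n) * q ^ n))"
    proof (rule norm_suminf_le[where 'a=real, unfolded real_norm_def])
      show "\<bar>q ^ n * t (Suc n)\<bar> \<le> K * q ^ n + e * (real (Suc n) * q ^ n)" for n
        using mult_left_mono[OF K[of "Suc n"], of "q ^ n"] q by (simp add: abs_mult algebra_simps)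
      show "summable (\<lambda>n. K * q ^ n + e * (real (Suc n) * q ^ n))"
        by (intro summable_add summable_mult g d)
    qed
    also have "\<dots> = K * (1 / (1 - q)) + e * (1 / (1 - q)\<^sup>2)"
      using g d by (simp add: suminf_add[symmetric] summable_mult suminf_mult del: of_nat_Suc)
    finally have "(1 - q)\<^sup>2 * \<bar>\<Sum>n. q ^ n * t (Suc n)\<bar>
        \<le> (1 - q)\<^sup>2 * (K * (1 / (1 - q)) + e * (1 / (1 - q)\<^sup>2))"
      by (intro mult_left_mono) auto
    also have "\<dots> = K * (1 - q) + e"
      using q by (simp add: distrib_left power2_eq_square)
    finally show ?thesis by (simp add: abs_mult)
  qed
  note left = eventually_at_left_1_unit
  show "((\<lambda>q. (1 - q) * (\<Sum>n. q ^ n * a n)) \<longlongrightarrow> L) (at_left 1)"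
  proof (rule tendstoI)
    fix e :: real assume "0 < e"
    obtain K where K: "\<And>n. \<bar>t n\<bar> \<le> K + e / 2 * real n"
      using bounded_cesaro_error[OF lim_t, of "e / 2"] \<open>0 < e\<close> by auto
    have "((\<lambda>q. K * (1 - q) + e / 2) \<longlongrightarrow> K * (1 - 1) + e / 2) (at_left 1)"
      by (intro tendsto_intros)
    then have "\<forall>\<^sub>F q in at_left 1. K * (1 - q) + e / 2 < e"
      by (rule order_tendstoD(2)) (use \<open>0 < e\<close> in simp)
    with left show "\<forall>\<^sub>F q in at_left 1. dist ((1 - q) * (\<Sum>n. q ^ n * a n)) L < e"
    proof eventually_elim
      case (elim q)
      then show ?case
        using diff[of q] bound[of q K "e / 2", OF _ _ K] by (simp add: dist_real_def)
    qed
  qed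
qed

text \<open>The substitution \<open>q = b\<^sup>c\<close>; the factor \<open>1 / c\<close> is the limit of \<open>(1 - b) / (1 - b\<^sup>c)\<close>, that is, the
  reciprocal of the derivative of \<open>b\<^sup>c\<close> at \<open>1\<close>.\<close>

lemma abelian_mean_powr:
  fixes a :: "nat \<Rightarrow> real"
  assumes mean: "(\<lambda>n. (\<Sum>i<n. a i) / real n) \<longlonglongrightarrow> L" and c: "0 < c"
  shows "\<And>b. 0 < b \<Longrightarrow> b < 1 \<Longrightarrow> summable (\<lambda>n. b powr (c * real n) * a n)"
    and "((\<lambda>b. (1 - b) * (\<Sum>n. b powr (c * real n) * a n)) \<longlongrightarrow> L / c) (at_left 1)"
proof -
  have pw: "b powr (c * real n) = (b powr c) ^ n" if "0 < b" for b :: real and n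
    using that by (simp add: powr_powr[symmetric] powr_realpow)
  have lt: "b powr c < 1" if "0 < b" "b < 1" for b :: real
    using that c powr_less_mono2[of c b 1] by simp
  show "summable (\<lambda>n. b powr (c * real n) * a n)" if "0 < b" "b < 1" for b
    using abelian_mean(1)[OF mean, of "b powr c"] lt[OF that] that by (simp add: pw)
  note left = eventually_at_left_1_unit
  have "((\<lambda>b. b powr c) \<longlongrightarrow> 1 powr c) (at_left (1::real))"
    by (intro tendsto_intros) auto
  moreover have "\<forall>\<^sub>F b in at_left (1::real). b powr c \<in> {..<1} \<and> b powr c \<noteq> 1"
    using left by eventually_elim (use lt in force)
  ultimately have "filterlim (\<lambda>b::real. b powr c) (at_left 1) (at_left 1)"
    by (simp add: filterlim_at)
  then have 1: "((\<lambda>b. (1 - b powr c) * (\<Sum>n. (b powr c) ^ n * a n)) \<longlongrightarrow> L) (at_left 1)"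
    by (rule filterlim_compose[OF abelian_mean(2)[OF mean]])
  have "((\<lambda>b. b powr c) has_real_derivative c * 1 powr (c - 1)) (at (1::real))"
    by (rule has_real_derivative_powr) simp
  then have "((\<lambda>b. (b powr c - 1 powr c) / (b - 1)) \<longlongrightarrow> c) (at (1::real))"
    by (simp add: has_field_derivative_iff)
  then have "((\<lambda>b. (b powr c - 1 powr c) / (b - 1)) \<longlongrightarrow> c) (at_left (1::real))"
    by (rule tendsto_mono[rotated]) (simp add: at_le)
  then have "((\<lambda>b. (1 - b powr c) * (\<Sum>n. (b powr c) ^ n * a n) / ((b powr c - 1 powr c) / (b - 1)))
      \<longlongrightarrow> L / c) (at_left 1)"
    using 1 c by (intro tendsto_divide) auto
  moreover have "\<forall>\<^sub>F b in at_left 1.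
      (1 - b powr c) * (\<Sum>n. (b powr c) ^ n * a n) / ((b powr c - 1 powr c) / (b - 1))
      = (1 - b) * (\<Sum>n. b powr (c * real n) * a n)"
    using left
  proof eventually_elim
    case (elim b)
    moreover have "x * y / ((z - 1) / (b - 1)) = (1 - b) * y" if "x = 1 - z" "z < 1" for x y z
      using that elim by (simp add: divide_simps) (simp add: algebra_simps)
    ultimately show ?case using lt[of b] by (simp add: pw)
  qed
  ultimately show "((\<lambda>b. (1 - b) * (\<Sum>n. b powr (c * real n) * a n)) \<longlongrightarrow> L / c) (at_left 1)"
    by (simp cong: tendsto_cong)
qed

text \<open>A larger exponent means a smaller weight. Ordering the exponents only from index \<open>K\<close> on costs
  finitely many terms, which the factor \<open>1 - b\<close> removes in the limit.\<close>

lemma discounted_sum_compare: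
  fixes s r a :: "nat \<Rightarrow> real"
  assumes b: "0 < b" "b < 1" and a: "\<And>n. 0 \<le> a n"
    and le: "\<And>n. K \<le> n \<Longrightarrow> r n \<le> s n" and r: "summable (\<lambda>n. b powr r n * a n)"
  shows "summable (\<lambda>n. b powr s n * a n)"
    and "(\<Sum>n. b powr s n * a n) \<le> (\<Sum>n<K. b powr s n * a n) + (\<Sum>n. b powr r n * a n)"
proof -
  have dom: "b powr s n * a n \<le> b powr r n * a n" if "K \<le> n" for n
    using le[OF that] b by (intro mult_right_mono a powr_mono') auto
  show summ: "summable (\<lambda>n. b powr s n * a n)"
    using dom a by (intro summable_comparison_test'[OF r, of K]) simp
  have "(\<Sum>n. b powr s (n + K) * a (n + K)) \<le> (\<Sum>n. b powr r (n + K) * a (n + K))"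
    using dom summ r by (intro suminf_le) (auto intro: summable_ignore_initial_segment)
  also have "\<dots> \<le> (\<Sum>n. b powr r n * a n)"
    using suminf_split_initial_segment[OF r, of K] by (simp add: sum_nonneg a)
  finally show "(\<Sum>n. b powr s n * a n) \<le> (\<Sum>n<K. b powr s n * a n) + (\<Sum>n. b powr r n * a n)"
    using suminf_split_initial_segment[OF summ, of K] by simp
qed

text \<open>For every \<open>c < \<mu> < d\<close> the walk lies between \<open>c n\<close> and \<open>d n\<close> from some index on, so that the
  discounted sum is squeezed between sums with exact linear exponents, whose limits are \<open>L / d\<close> and
  \<open>L / c\<close>; then \<open>c\<close> and \<open>d\<close> tend to \<open>\<mu>\<close>. The squeeze needs nonnegative terms \<open>a\<close>.\<close>

theorem discounted_sum_along_linear_walk: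
  fixes s a :: "nat \<Rightarrow> real"
  assumes drift: "(\<lambda>n. s n / real n) \<longlonglongrightarrow> \<mu>" and \<mu>: "0 < \<mu>"
    and a: "\<And>n. 0 \<le> a n" and mean: "(\<lambda>n. (\<Sum>i<n. a i) / real n) \<longlonglongrightarrow> L"
  shows "\<And>b. 0 < b \<Longrightarrow> b < 1 \<Longrightarrow> summable (\<lambda>n. b powr s n * a n)"
    and "((\<lambda>b. (1 - b) * (\<Sum>n. b powr s n * a n)) \<longlongrightarrow> L / \<mu>) (at_left 1)"
proof -
  note lin = abelian_mean_powr[OF mean]
  have below: "\<exists>K. \<forall>n\<ge>K. c * real n \<le> s n" if "c < \<mu>" for c
  proof -
    have "\<forall>\<^sub>F n in sequentially. c < s n / real n \<and> 0 < n"
      using order_tendstoD(1)[OF drift that] eventually_gt_at_top[of 0] by (rule eventually_conj)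
    then show ?thesis
      unfolding eventually_sequentially by (force simp: pos_less_divide_eq)
  qed
  have above: "\<exists>K. \<forall>n\<ge>K. s n \<le> c * real n" if "\<mu> < c" for c
  proof -
    have "\<forall>\<^sub>F n in sequentially. s n / real n < c \<and> 0 < n"
      using order_tendstoD(2)[OF drift that] eventually_gt_at_top[of 0] by (rule eventually_conj)
    then show ?thesis
      unfolding eventually_sequentially by (force simp: pos_divide_less_eq)
  qed
  show summ: "summable (\<lambda>n. b powr s n * a n)" if b: "0 < b" "b < 1" for b
  proof -
    obtain K where "\<And>n. K \<le> n \<Longrightarrow> \<mu> / 2 * real n \<le> s n"
      using below[of "\<mu> / 2"] \<mu> by auto
    then show ?thesis
      using discounted_sum_compare(1)[OF b a _ lin(1)[OF _ b], of K "\<mu> / 2" s] \<mu> by simp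
  qed
  have head: "((\<lambda>b. (1 - b) * (\<Sum>n<K. b powr r n * a n)) \<longlongrightarrow> 0) (at_left 1)"
    for K :: nat and r :: "nat \<Rightarrow> real"
  proof -
    have "((\<lambda>b. (1 - b) * (\<Sum>n<K. b powr r n * a n)) \<longlongrightarrow> (1 - 1) * (\<Sum>n<K. 1 powr r n * a n)) (at_left 1)"
      by (intro tendsto_intros) auto
    then show ?thesis by simp
  qed
  note left = eventually_at_left_1_unit
  show "((\<lambda>b. (1 - b) * (\<Sum>n. b powr s n * a n)) \<longlongrightarrow> L / \<mu>) (at_left 1)"
  proof (rule order_tendstoI)
    fix u assume u: "L / \<mu> < u"
    have "((\<lambda>c. L / c) \<longlongrightarrow> L / \<mu>) (at_left \<mu>)"
      using \<mu> by (intro tendsto_intros) auto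
    then have "\<forall>\<^sub>F c in at_left \<mu>. L / c < u"
      using u by (rule order_tendstoD)
    moreover have "\<forall>\<^sub>F c in at_left \<mu>. 0 < c \<and> c < \<mu>"
      using \<mu> by (intro eventually_at_leftI[of 0]) auto
    ultimately have "\<forall>\<^sub>F c in at_left \<mu>. L / c < u \<and> 0 < c \<and> c < \<mu>"
      by (rule eventually_conj)
    then obtain c where c: "L / c < u" "0 < c" "c < \<mu>"
      using eventually_happens[of _ "at_left \<mu>"] by auto
    obtain K where K: "\<And>n. K \<le> n \<Longrightarrow> c * real n \<le> s n"
      using below[OF c(3)] by auto
    have "((\<lambda>b. (1 - b) * (\<Sum>n<K. b powr s n * a n) + (1 - b) * (\<Sum>n. b powr (c * real n) * a n))
        \<longlongrightarrow> 0 + L / c) (at_left 1)"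
      by (intro tendsto_add head lin(2) c)
    then have "\<forall>\<^sub>F b in at_left 1.
        (1 - b) * (\<Sum>n<K. b powr s n * a n) + (1 - b) * (\<Sum>n. b powr (c * real n) * a n) < u"
      using c by (auto dest: order_tendstoD(2))
    with left show "\<forall>\<^sub>F b in at_left 1. (1 - b) * (\<Sum>n. b powr s n * a n) < u"
    proof eventually_elim
      case (elim b)
      then have b: "0 < b" "b < 1" by auto
      have "(1 - b) * (\<Sum>n. b powr s n * a n)
          \<le> (1 - b) * ((\<Sum>n<K. b powr s n * a n) + (\<Sum>n. b powr (c * real n) * a n))"
        using b by (intro mult_left_mono discounted_sum_compare(2) a K lin(1) c) auto
      then show ?case
        using elim by (simp add: distrib_left)
    qed
  next
    fix l assume l: "l < L / \<mu>"
    have "((\<lambda>c. L / c) \<longlongrightarrow> L / \<mu>) (at_right \<mu>)"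
      using \<mu> by (intro tendsto_intros) auto
    then have "\<forall>\<^sub>F c in at_right \<mu>. l < L / c"
      using l by (rule order_tendstoD)
    then have "\<forall>\<^sub>F c in at_right \<mu>. l < L / c \<and> \<mu> < c"
      using eventually_at_right_less by (rule eventually_conj)
    then obtain c where c: "l < L / c" "\<mu> < c"
      using eventually_happens[of _ "at_right \<mu>"] by auto
    then have "0 < c" using \<mu> by simp
    obtain K where K: "\<And>n. K \<le> n \<Longrightarrow> s n \<le> c * real n"
      using above[OF c(2)] by auto
    have "((\<lambda>b. (1 - b) * (\<Sum>n. b powr (c * real n) * a n) - (1 - b) * (\<Sum>n<K. b powr (c * real n) * a n))
        \<longlongrightarrow> L / c - 0) (at_left 1)"
      by (intro tendsto_diff head lin(2) \<open>0 < c\<close>)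
    then have "\<forall>\<^sub>F b in at_left 1.
        l < (1 - b) * (\<Sum>n. b powr (c * real n) * a n) - (1 - b) * (\<Sum>n<K. b powr (c * real n) * a n)"
      using c by (auto dest: order_tendstoD(1))
    with left show "\<forall>\<^sub>F b in at_left 1. l < (1 - b) * (\<Sum>n. b powr s n * a n)"
    proof eventually_elim
      case (elim b)
      then have b: "0 < b" "b < 1" by auto
      have "(1 - b) * (\<Sum>n. b powr (c * real n) * a n)
          \<le> (1 - b) * ((\<Sum>n<K. b powr (c * real n) * a n) + (\<Sum>n. b powr s n * a n))"
        using b by (intro mult_left_mono discounted_sum_compare(2) a K summ) auto
      then show ?case
        using elim by (simp add: distrib_left)
    qed
  qed
qed

section \<open>Discounted sums along a random walk\<close>

text \<open>Only averages of real functions of one copy are ever used: of \<open>\<xi>\<close> and of the positive and negative parts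
  of \<open>\<eta>\<close>. Copies are indexed from \<open>1\<close>, hence the shift by \<open>Suc\<close>.\<close>

lemma AE_mean_of_copies:
  fixes g :: "real \<times> real \<Rightarrow> real"
  assumes "prob_space M" and Z: "Z \<in> borel_measurable M" and copies: "independent_copies M Z Zs"
    and g: "g \<in> borel_measurable borel" and int: "integrable M (\<lambda>\<omega>. g (Z \<omega>))"
  shows "AE \<omega> in M. (\<lambda>n. (\<Sum>i<n. g (Zs (Suc i) \<omega>)) / real n) \<longlonglongrightarrow> (\<integral>\<omega>. g (Z \<omega>) \<partial>M)"
proof -
  interpret prob_space M by fact
  have range: "Suc ` UNIV = {1..}"
    by (auto simp: image_iff Suc_le_eq gr0_conv_Suc)
  have indep: "indep_vars (\<lambda>_. borel) (\<lambda>i. Zs (Suc i)) UNIV"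
    using copies indep_vars_reindex_inj[of "\<lambda>_. borel" Zs Suc UNIV]
    by (simp add: independent_copies_def range)
  have Zs: "Zs (Suc i) \<in> borel_measurable M" for i
    using indep by (simp add: indep_vars_def2)
  have law: "distr M borel (\<lambda>\<omega>. g (Zs (Suc i) \<omega>)) = distr M borel (\<lambda>\<omega>. g (Z \<omega>))" for i
    by (rule distr_compose_cong[OF _ Zs Z g]) (use copies in \<open>simp add: independent_copies_def\<close>)
  have gZs: "(\<lambda>\<omega>. g (Zs (Suc i) \<omega>)) \<in> borel_measurable M" for i
    by (rule measurable_compose[OF Zs g])
  have gZ: "(\<lambda>\<omega>. g (Z \<omega>)) \<in> borel_measurable M"
    by (rule measurable_compose[OF Z g])
  have "AE \<omega> in M. (\<lambda>n. (\<Sum>i<n. g (Zs (Suc i) \<omega>)) / real n)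
      \<longlonglongrightarrow> expectation (\<lambda>\<omega>. g (Zs (Suc 0) \<omega>))"
  proof (rule strong_law_of_large_numbers)
    show "indep_vars (\<lambda>_. borel) (\<lambda>i \<omega>. g (Zs (Suc i) \<omega>)) UNIV"
      by (rule indep_vars_compose2[OF indep, of "\<lambda>_. g"]) (rule g)
    show "distr M borel (\<lambda>\<omega>. g (Zs (Suc i) \<omega>)) = distr M borel (\<lambda>\<omega>. g (Zs (Suc 0) \<omega>))" for i
      by (simp only: law)
    have "integrable (distr M borel (\<lambda>\<omega>. g (Z \<omega>))) (\<lambda>s. s)"
      using int gZ by (simp add: integrable_distr_eq)
    then have "integrable (distr M borel (\<lambda>\<omega>. g (Zs (Suc 0) \<omega>))) (\<lambda>s. s)"
      by (simp only: law)
    then show "integrable M (\<lambda>\<omega>. g (Zs (Suc 0) \<omega>))"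
      by (rule integrable_distr[OF gZs])
  qed
  moreover have "expectation (\<lambda>\<omega>. g (Zs (Suc 0) \<omega>)) = expectation (\<lambda>\<omega>. g (Z \<omega>))"
    using integral_distr[OF gZs, of "\<lambda>s. s" 0] integral_distr[OF gZ, of "\<lambda>s. s"]
    unfolding law by simp
  ultimately show ?thesis by simp
qed

theorem theorem1p1:
  fixes M :: "'a measure"
    and \<xi> \<eta> :: "'a \<Rightarrow> real"
    and \<xi>s \<eta>s :: "nat \<Rightarrow> 'a \<Rightarrow> real"
    and \<mu> m :: real
  assumes "prob_space M"
    and "(\<lambda>\<omega>. (\<xi> \<omega>, \<eta> \<omega>)) \<in> borel_measurable M"
    and "independent_copies M (\<lambda>\<omega>. (\<xi> \<omega>, \<eta> \<omega>)) (\<lambda>k \<omega>. (\<xi>s k \<omega>, \<eta>s k \<omega>))"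
    and "integrable M \<xi>" and "\<mu> = integral\<^sup>L M \<xi>" and "\<mu> > 0"
    and "integrable M \<eta>" and "m = integral\<^sup>L M \<eta>"
  shows "AE \<omega> in M.
    (\<forall>b\<in>{0<..<1}. summable (\<lambda>k. \<bar>b powr random_walk \<xi>s k \<omega> * \<eta>s (Suc k) \<omega>\<bar>)) \<and>
    ((\<lambda>b. (1 - b) * (\<Sum>k. b powr random_walk \<xi>s k \<omega> * \<eta>s (Suc k) \<omega>))
       \<longlongrightarrow> inverse \<mu> * m) (at_left 1)"
proof -
  note mean = AE_mean_of_copies[OF assms(1,2,3)]
  let ?P = "\<integral>\<omega>. max 0 (\<eta> \<omega>) \<partial>M" and ?N = "\<integral>\<omega>. max 0 (- \<eta> \<omega>) \<partial>M"
  have int: "integrable M (\<lambda>\<omega>. max 0 (\<eta> \<omega>))" "integrable M (\<lambda>\<omega>. max 0 (- \<eta> \<omega>))"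
    using assms(7) by (auto intro: integrable_max)
  have "?P - ?N = (\<integral>\<omega>. max 0 (\<eta> \<omega>) - max 0 (- \<eta> \<omega>) \<partial>M)"
    using int by simp
  also have "\<dots> = m"
    unfolding assms(8) by (intro Bochner_Integration.integral_cong) (auto simp: max_def)
  finally have m: "?P - ?N = m" .
  have drift: "AE \<omega> in M. (\<lambda>n. (\<Sum>i<n. \<xi>s (Suc i) \<omega>) / real n) \<longlonglongrightarrow> \<mu>"
    using mean[of fst] assms(4,5) by (simp add: borel_measurable_continuous_onI continuous_on_fst)
  have pos: "AE \<omega> in M. (\<lambda>n. (\<Sum>i<n. max 0 (\<eta>s (Suc i) \<omega>)) / real n) \<longlonglongrightarrow> ?P"
    using mean[of "\<lambda>z. max 0 (snd z)"] int
    by (simp add: borel_measurable_continuous_onI continuous_on_max continuous_on_snd)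
  have neg: "AE \<omega> in M. (\<lambda>n. (\<Sum>i<n. max 0 (- \<eta>s (Suc i) \<omega>)) / real n) \<longlonglongrightarrow> ?N"
    using mean[of "\<lambda>z. max 0 (- snd z)"] int
    by (simp add: borel_measurable_continuous_onI continuous_on_max continuous_on_minus continuous_on_snd)
  from drift pos neg show ?thesis
  proof eventually_elim
    case (elim \<omega>)
    let ?w = "\<lambda>b k. b powr random_walk \<xi>s k \<omega>"
    let ?p = "\<lambda>k. max 0 (\<eta>s (Suc k) \<omega>)" and ?n = "\<lambda>k. max 0 (- \<eta>s (Suc k) \<omega>)"
    have walk: "(\<lambda>k. random_walk \<xi>s k \<omega> / real k) \<longlonglongrightarrow> \<mu>"
      using elim(1) by (simp add: random_walk_def sum.atLeast1_atMost_eq)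
    note P = discounted_sum_along_linear_walk[OF walk assms(6) _ elim(2), simplified]
    note N = discounted_sum_along_linear_walk[OF walk assms(6) _ elim(3), simplified]
    have abs: "\<bar>?w b k * \<eta>s (Suc k) \<omega>\<bar> = ?w b k * ?p k + ?w b k * ?n k" for b k
      by (simp add: abs_mult max_def)
    have split: "?w b k * \<eta>s (Suc k) \<omega> = ?w b k * ?p k - ?w b k * ?n k" for b k
      by (simp add: max_def)
    have "((\<lambda>b. (1 - b) * (\<Sum>k. ?w b k * ?p k) - (1 - b) * (\<Sum>k. ?w b k * ?n k))
        \<longlongrightarrow> ?P / \<mu> - ?N / \<mu>) (at_left 1)"
      by (intro tendsto_diff P(2) N(2))
    also have "?P / \<mu> - ?N / \<mu> = inverse \<mu> * m"
      by (simp add: m[symmetric] divide_inverse algebra_simps)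
    finally have "((\<lambda>b. (1 - b) * (\<Sum>k. ?w b k * ?p k) - (1 - b) * (\<Sum>k. ?w b k * ?n k))
        \<longlongrightarrow> inverse \<mu> * m) (at_left 1)" .
    moreover have "\<forall>\<^sub>F b in at_left 1.
        (1 - b) * (\<Sum>k. ?w b k * ?p k) - (1 - b) * (\<Sum>k. ?w b k * ?n k)
        = (1 - b) * (\<Sum>k. ?w b k * \<eta>s (Suc k) \<omega>)"
      using eventually_at_left_1_unit
    proof eventually_elim
      case (elim b)
      then show ?case
        unfolding split by (simp add: suminf_diff[symmetric] P(1) N(1) right_diff_distrib)
    qed
    ultimately have "((\<lambda>b. (1 - b) * (\<Sum>k. ?w b k * \<eta>s (Suc k) \<omega>)) \<longlongrightarrow> inverse \<mu> * m) (at_left 1)"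
      by (rule Lim_transform_eventually)
    moreover have "\<forall>b\<in>{0<..<1}. summable (\<lambda>k. \<bar>?w b k * \<eta>s (Suc k) \<omega>\<bar>)"
      unfolding abs by (auto intro!: summable_add P(1) N(1))
    ultimately show ?case by blast
  qed
qed

end
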